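(* Let $(X,d,A)$ be a metric pair with $A\neq\emptyset$ and let $0\le p\le\infty$. Then $\mathcal{M}_p^+(X,A)$ is an ideal in the zero-sum-free Riesz cone $\hat{\mathcal{M}}_p^+(X,A)$.
   Context: A metric pair $(X,d,A)$ is a metric space $(X,d)$ with a closed subset $A\subset X$; $d_A(x)=\inf_{a\in A}d(x,a)$. Measures take values in $[0,\infty]$. Let $\mathcal{B}^+(X)$ be the commutative monoid of Borel measures on $X$ and $\mathcal{B}^+(X,A)=\mathcal{B}^+(X)/\mathcal{B}^+(A)$ the quotient monoid: $\mu\sim\nu$ iff $\mu+\sigma=\nu+\tau$ for some Borel measures $\sigma,\tau$ concentrated on $A$; equivalently $\mu,\nu$ agree on Borel subsets of $X\setminus A$, so relative Borel measures correspond bijectively to Borel measures on $X\setminus A$. $\mu\in\mathcal{B}^+(X,A)$ is tight if $\mu(E)=\sup\{\mu(K): K\subset E \text{ compact}\}$ for every Borel $E\subset X\setminus A$. For $p<\infty$, $\mu$ is $p$-finite if $\int_{X\setminus A}d_A^p\,d\mu<\infty$ (for $p=0$: $\mu(X\setminus A)<\infty$); $\mu$ is $\infty$-finite if $\mu(\{d_A>\varepsilon\})<\infty$ for all $\varepsilon>0$ and $\mu(\{d_A>\delta\})=0$ for some $\delta>0$. $\mu$ is locally $p$-finite if each $x\in X$ (including $x\in A$) has a neighborhood $U$ such that $\mu_U$, $\mu_U(E)=\mu(E\cap U)$, is $p$-finite. $\mathcal{M}_p^+(X,A)$ (resp. $\hat{\mathcal{M}}_p^+(X,A)$) is the set of tight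 $\mu\in\mathcal{B}^+(X,A)$ that are $p$-finite (resp. locally $p$-finite). A convex cone is a commutative monoid with a compatible action of the semiring $\mathbb{R}^+=[0,\infty)$; its natural preorder is $x\le y$ iff $x+z=y$ for some $z$. A Riesz cone is a cancellative convex cone whose natural preorder is a partial order for which every pair has a supremum $x\vee y$, with $(x\vee y)+z=(x+z)\vee(y+z)$. It is zero-sum-free if $x+y=0$ implies $x=y=0$. $\hat{\mathcal{M}}_p^+(X,A)$, with addition of measures and $a\cdot\mu=a\mu$, is a zero-sum-free Riesz cone whose natural order is $\mu\le\nu$ iff $\mu(E)\le\nu(E)$ for all Borel $E\subset X\setminus A$. A subset $I$ of a zero-sum-free Riesz cone $C$ is solid if $y\in I$, $x\in C$, $x\le y$ imply $x\in I$. An ideal in $C$ is a solid Riesz subcone, where a Riesz subcone contains $0$ and is closed under addition, the $\mathbb{R}^+$-action and $\vee$. *)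

theory Defs
  imports "HOL-Analysis.Analysis" "HOL-Algebra.Group" "HOL-Algebra.Lattice"
begin

section \<open>Riesz cones and ideals\<close>

record 'c cone = "'c partial_object" +
  cadd :: "'c \<Rightarrow> 'c \<Rightarrow> 'c" (infixl \<open>\<boxplus>\<index>\<close> 65)
  czero :: "'c" (\<open>\<zero>\<^sub>C\<index>\<close>)
  cscale :: "real \<Rightarrow> 'c \<Rightarrow> 'c" (infixr \<open>\<cdot>\<index>\<close> 75)

definition additive_monoid :: "('c, 'b) cone_scheme \<Rightarrow> 'c monoid" where
  "additive_monoid C = \<lparr>carrier = carrier C, mult = cadd C, one = czero C\<rparr>"

locale abstract_convex_cone =
  fixes C (structure)
  assumes additive_comm_monoid: "comm_monoid (additive_monoid C)"
    and scale_closed: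
      "\<lbrakk>0 \<le> a; x \<in> carrier C\<rbrakk> \<Longrightarrow> a \<cdot> x \<in> carrier C"
    and scale_add_right:
      "\<lbrakk>0 \<le> a; x \<in> carrier C; y \<in> carrier C\<rbrakk> \<Longrightarrow> a \<cdot> (x \<boxplus> y) = a \<cdot> x \<boxplus> a \<cdot> y"
    and scale_add_left:
      "\<lbrakk>0 \<le> a; 0 \<le> b; x \<in> carrier C\<rbrakk> \<Longrightarrow> (a + b) \<cdot> x = a \<cdot> x \<boxplus> b \<cdot> x"
    and scale_mult:
      "\<lbrakk>0 \<le> a; 0 \<le> b; x \<in> carrier C\<rbrakk> \<Longrightarrow> (a * b) \<cdot> x = a \<cdot> (b \<cdot> x)"
    and scale_one: "x \<in> carrier C \<Longrightarrow> 1 \<cdot> x = x"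
    and scale_zero_left: "x \<in> carrier C \<Longrightarrow> 0 \<cdot> x = \<zero>\<^sub>C"
    and scale_zero_right: "0 \<le> a \<Longrightarrow> a \<cdot> \<zero>\<^sub>C = \<zero>\<^sub>C"

definition natural_order :: "('c, 'b) cone_scheme \<Rightarrow> 'c gorder" where
  "natural_order C =
     \<lparr>carrier = carrier C, eq = (=),
      le = (\<lambda>x y. \<exists>z\<in>carrier C. x \<boxplus>\<^bsub>C\<^esub> z = y)\<rparr>"

text \<open>Being an upper semilattice means that the natural preorder is a partial order in which
  every pair of elements has a supremum; that supremum is \<open>join (natural_order C)\<close>.\<close>

locale riesz_cone = abstract_convex_cone +
  assumes cancel:
      "\<lbrakk>x \<in> carrier C; y \<in> carrier C; z \<in> carrier C; x \<boxplus> z = y \<boxplus> z\<rbrakk> \<Longrightarrow> x = y"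
    and natural_order_semilattice: "upper_semilattice (natural_order C)"
    and join_add:
      "\<lbrakk>x \<in> carrier C; y \<in> carrier C; z \<in> carrier C\<rbrakk> \<Longrightarrow>
        (x \<squnion>\<^bsub>natural_order C\<^esub> y) \<boxplus> z = (x \<boxplus> z) \<squnion>\<^bsub>natural_order C\<^esub> (y \<boxplus> z)"

locale zero_sum_free_riesz_cone = riesz_cone +
  assumes zero_sum_free:
    "\<lbrakk>x \<in> carrier C; y \<in> carrier C; x \<boxplus> y = \<zero>\<^sub>C\<rbrakk> \<Longrightarrow> x = \<zero>\<^sub>C \<and> y = \<zero>\<^sub>C"

definition riesz_subcone :: "'c set \<Rightarrow> ('c, 'b) cone_scheme \<Rightarrow> bool" where
  "riesz_subcone I C \<longleftrightarrow>
     I \<subseteq> carrier C \<and> czero C \<in> I \<and>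
     (\<forall>x\<in>I. \<forall>y\<in>I. x \<boxplus>\<^bsub>C\<^esub> y \<in> I) \<and>
     (\<forall>a\<ge>0. \<forall>x\<in>I. a \<cdot>\<^bsub>C\<^esub> x \<in> I) \<and>
     (\<forall>x\<in>I. \<forall>y\<in>I. x \<squnion>\<^bsub>natural_order C\<^esub> y \<in> I)"

definition solid :: "'c set \<Rightarrow> ('c, 'b) cone_scheme \<Rightarrow> bool" where
  "solid I C \<longleftrightarrow>
     I \<subseteq> carrier C \<and>
     (\<forall>y\<in>I. \<forall>x\<in>carrier C. x \<sqsubseteq>\<^bsub>natural_order C\<^esub> y \<longrightarrow> x \<in> I)"

definition riesz_ideal :: "'c set \<Rightarrow> ('c, 'b) cone_scheme \<Rightarrow> bool" where
  "riesz_ideal I C \<longleftrightarrow> zero_sum_free_riesz_cone C \<and> riesz_subcone I C \<and> solid I C"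


section \<open>Relative Borel measures\<close>

definition borel_measures :: "'a::metric_space measure set" where
  "borel_measures = {\<mu>. sets \<mu> = sets borel}"

definition add_measure :: "'a::metric_space measure \<Rightarrow> 'a measure \<Rightarrow> 'a measure" where
  "add_measure \<mu> \<nu> = measure_of UNIV (sets borel) (\<lambda>E. emeasure \<mu> E + emeasure \<nu> E)"

text \<open>Borel measures on the closed set \<open>A\<close> are regarded as the Borel measures on the whole
  space that are concentrated on \<open>A\<close>.\<close>

definition concentrated_on :: "'a::metric_space set \<Rightarrow> 'a measure set" where
  "concentrated_on A = {\<sigma> \<in> borel_measures. emeasure \<sigma> (- A) = 0}"

definition rel_equiv :: "'a::metric_space set \<Rightarrow> ('a measure \<times> 'a measure) set" where
  "rel_equiv A =
     {(\<mu>, \<nu>). \<mu> \<in> borel_measures \<and> \<nu> \<in> borel_measures \<and>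
       (\<exists>\<sigma>\<in>concentrated_on A. \<exists>\<tau>\<in>concentrated_on A. add_measure \<mu> \<sigma> = add_measure \<nu> \<tau>)}"

definition relative_measures :: "'a::metric_space set \<Rightarrow> 'a measure set set" where
  "relative_measures A = borel_measures // rel_equiv A"

definition rel_add ::
    "'a::metric_space set \<Rightarrow> 'a measure set \<Rightarrow> 'a measure set \<Rightarrow> 'a measure set" where
  "rel_add A c d = (\<Union>\<mu>\<in>c. \<Union>\<nu>\<in>d. rel_equiv A `` {add_measure \<mu> \<nu>})"

definition rel_zero :: "'a::metric_space set \<Rightarrow> 'a measure set" where
  "rel_zero A = rel_equiv A `` {null_measure borel}"

definition rel_scale ::
    "'a::metric_space set \<Rightarrow> real \<Rightarrow> 'a measure set \<Rightarrow> 'a measure set" where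
  "rel_scale A a c = (\<Union>\<mu>\<in>c. rel_equiv A `` {scale_measure (ennreal a) \<mu>})"

definition tight :: "'a::metric_space set \<Rightarrow> 'a measure \<Rightarrow> bool" where
  "tight A \<mu> \<longleftrightarrow>
     (\<forall>E\<in>sets borel. E \<subseteq> - A \<longrightarrow>
        emeasure \<mu> E = (SUP K\<in>{K. compact K \<and> K \<subseteq> E}. emeasure \<mu> K))"

text \<open>For nonempty \<open>A\<close>, \<open>infdist x A\<close> is the infimum of the distances from \<open>x\<close> to points of
  \<open>A\<close>; if \<open>A\<close> is also closed, it is positive off \<open>A\<close>. Hence for \<open>p = 0\<close> the integrand below
  is 1 and the condition says that the complement of \<open>A\<close> has finite measure.\<close>

definition p_finite :: "'a::metric_space set \<Rightarrow> ennreal \<Rightarrow> 'a measure \<Rightarrow> bool" where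
  "p_finite A p \<mu> \<longleftrightarrow>
     (if p = \<infinity> then
        (\<forall>\<epsilon>>0. emeasure \<mu> {x. infdist x A > \<epsilon>} < \<infinity>) \<and>
        (\<exists>\<delta>>0. emeasure \<mu> {x. infdist x A > \<delta>} = 0)
      else (\<integral>\<^sup>+x\<in>- A. ennreal (infdist x A powr enn2real p) \<partial>\<mu>) < \<infinity>)"

text \<open>\<open>density \<mu> (indicator U)\<close> is the measure sending \<open>E\<close> to \<open>emeasure \<mu> (E \<inter> U)\<close>. This requires
  \<open>U\<close> to be measurable, so neighborhoods are taken to be Borel; every neighborhood contains an
  open one.\<close>

definition locally_p_finite :: "'a::metric_space set \<Rightarrow> ennreal \<Rightarrow> 'a measure \<Rightarrow> bool" where
  "locally_p_finite A p \<mu> \<longleftrightarrow>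
     (\<forall>x. \<exists>U\<in>sets borel. x \<in> interior U \<and> p_finite A p (density \<mu> (indicator U)))"

text \<open>The properties of measures above do not depend on the representative of a class (see
  \<open>tight_rel_equiv\<close>, \<open>p_finite_rel_equiv\<close>, \<open>locally_p_finite_rel_equiv\<close> below), so asking
  for all representatives is the same as asking for one.\<close>

definition finite_measures :: "'a::metric_space set \<Rightarrow> ennreal \<Rightarrow> 'a measure set set" where
  "finite_measures A p =
     {c \<in> relative_measures A. \<forall>\<mu>\<in>c. tight A \<mu> \<and> p_finite A p \<mu>}"

definition locally_finite_measures ::
    "'a::metric_space set \<Rightarrow> ennreal \<Rightarrow> 'a measure set set" where
  "locally_finite_measures A p =
     {c \<in> relative_measures A. \<forall>\<mu>\<in>c. tight A \<mu> \<and> locally_p_finite A p \<mu>}"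

definition locally_finite_measures_cone ::
    "'a::metric_space set \<Rightarrow> ennreal \<Rightarrow> 'a measure set cone" where
  "locally_finite_measures_cone A p =
     \<lparr>carrier = locally_finite_measures A p, cadd = rel_add A, czero = rel_zero A,
      cscale = rel_scale A\<rparr>"


subsection \<open>Well-definedness\<close>

lemma sets_add_measure [simp]: "sets (add_measure \<mu> \<nu>) = sets borel"
  unfolding add_measure_def
  by (metis sets.sets_measure_of_eq space_borel)

lemma emeasure_add_measure:
  assumes "\<mu> \<in> borel_measures" "\<nu> \<in> borel_measures" "E \<in> sets borel"
  shows "emeasure (add_measure \<mu> \<nu>) E = emeasure \<mu> E + emeasure \<nu> E"
proof (rule emeasure_measure_of[OF add_measure_def])
  show "sets borel \<subseteq> Pow (UNIV :: 'a set)" by simp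
  show "E \<in> sets (add_measure \<mu> \<nu>)" using assms by simp
  show "positive (sets (add_measure \<mu> \<nu>)) (\<lambda>E. emeasure \<mu> E + emeasure \<nu> E)"
    by (simp add: positive_def)
  show "countably_additive (sets (add_measure \<mu> \<nu>)) (\<lambda>E. emeasure \<mu> E + emeasure \<nu> E)"
  proof (rule countably_additiveI)
    fix F :: "nat \<Rightarrow> 'a set"
    assume F: "range F \<subseteq> sets (add_measure \<mu> \<nu>)" "disjoint_family F"
    have "range F \<subseteq> sets \<mu>" "range F \<subseteq> sets \<nu>"
      using F assms by (simp_all add: borel_measures_def)
    then show "(\<Sum>i. emeasure \<mu> (F i) + emeasure \<nu> (F i)) =
        emeasure \<mu> (\<Union> (range F)) + emeasure \<nu> (\<Union> (range F))"
      using F by (simp add: suminf_add[symmetric] suminf_emeasure)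
  qed
qed

lemma rel_equiv_iff:
  assumes "closed A"
  shows "(\<mu>, \<nu>) \<in> rel_equiv A \<longleftrightarrow>
    \<mu> \<in> borel_measures \<and> \<nu> \<in> borel_measures \<and>
    (\<forall>E\<in>sets borel. E \<subseteq> - A \<longrightarrow> emeasure \<mu> E = emeasure \<nu> E)" (is "?L \<longleftrightarrow> ?R")
proof
  assume L: ?L
  then obtain \<sigma> \<tau> where st: "\<sigma> \<in> concentrated_on A" "\<tau> \<in> concentrated_on A"
    and eq: "add_measure \<mu> \<sigma> = add_measure \<nu> \<tau>"
    and mn: "\<mu> \<in> borel_measures" "\<nu> \<in> borel_measures"
    unfolding rel_equiv_def by auto
  have zero: "emeasure \<rho> E = 0"
    if "\<rho> \<in> concentrated_on A" "E \<in> sets borel" "E \<subseteq> - A" for \<rho> E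
  proof -
    have "- A \<in> sets \<rho>" using that assms by (auto simp: concentrated_on_def borel_measures_def)
    then show ?thesis
      using emeasure_mono[of E "- A" \<rho>] that by (auto simp: concentrated_on_def)
  qed
  have "emeasure \<mu> E = emeasure \<nu> E" if E: "E \<in> sets borel" "E \<subseteq> - A" for E
  proof -
    have "\<sigma> \<in> borel_measures" "\<tau> \<in> borel_measures" using st by (auto simp: concentrated_on_def)
    then have "emeasure \<mu> E + emeasure \<sigma> E = emeasure \<nu> E + emeasure \<tau> E"
      using arg_cong[OF eq, of "\<lambda>\<rho>. emeasure \<rho> E"] mn E by (simp add: emeasure_add_measure)
    then show ?thesis using zero[OF st(1) E] zero[OF st(2) E] by simp
  qed
  then show ?R using mn by blast
next
  assume R: ?R
  then have mn: "sets \<mu> = sets borel" "sets \<nu> = sets borel" by (auto simp: borel_measures_def)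
  have Ab: "A \<in> sets borel" "- A \<in> sets borel" using assms by auto
  define \<sigma> where "\<sigma> = density \<nu> (indicator A)"
  define \<tau> where "\<tau> = density \<mu> (indicator A)"
  have b: "\<sigma> \<in> borel_measures" "\<tau> \<in> borel_measures"
    using mn by (auto simp: \<sigma>_def \<tau>_def borel_measures_def)
  have dens: "emeasure (density \<rho> (indicator A)) E = emeasure \<rho> (A \<inter> E)"
    if "sets \<rho> = sets borel" "E \<in> sets borel" for \<rho> :: "'a measure" and E
    using that Ab by (simp add: emeasure_density indicator_inter_arith[symmetric])
  have "add_measure \<mu> \<sigma> = add_measure \<nu> \<tau>"
  proof (rule measure_eqI)
    fix E assume "E \<in> sets (add_measure \<mu> \<sigma>)"
    then have E: "E \<in> sets borel" by simp
    have sp: "emeasure \<rho> E = emeasure \<rho> (A \<inter> E) + emeasure \<rho> (E - A)"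
      if "sets \<rho> = sets borel" for \<rho> :: "'a measure"
      using that E Ab by (subst plus_emeasure) (auto intro!: arg_cong[where f = "emeasure \<rho>"])
    have "emeasure \<mu> (E - A) = emeasure \<nu> (E - A)" using R E Ab by auto
    then show "emeasure (add_measure \<mu> \<sigma>) E = emeasure (add_measure \<nu> \<tau>) E"
      using R b E sp[OF mn(1)] sp[OF mn(2)] dens[OF mn(1) E] dens[OF mn(2) E]
      by (simp add: emeasure_add_measure \<sigma>_def \<tau>_def ac_simps)
  qed simp
  moreover have "\<sigma> \<in> concentrated_on A" "\<tau> \<in> concentrated_on A"
    using b dens[OF mn(1) Ab(2)] dens[OF mn(2) Ab(2)]
    by (auto simp: concentrated_on_def \<sigma>_def \<tau>_def)
  ultimately show ?L using R unfolding rel_equiv_def by auto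
qed

lemma equiv_rel_equiv: "closed A \<Longrightarrow> equiv borel_measures (rel_equiv A)"
  by (auto simp: equiv_def refl_on_def sym_def trans_def rel_equiv_iff)

lemma add_measure_rel_equiv:
  assumes "closed A" "(\<mu>, \<mu>') \<in> rel_equiv A" "(\<nu>, \<nu>') \<in> rel_equiv A"
  shows "(add_measure \<mu> \<nu>, add_measure \<mu>' \<nu>') \<in> rel_equiv A"
  using assms by (simp add: rel_equiv_iff emeasure_add_measure) (simp add: borel_measures_def)

lemma scale_measure_rel_equiv:
  assumes "closed A" "(\<mu>, \<mu>') \<in> rel_equiv A"
  shows "(scale_measure r \<mu>, scale_measure r \<mu>') \<in> rel_equiv A"
  using assms by (simp add: rel_equiv_iff borel_measures_def)

lemma tight_rel_equiv:
  assumes "closed A" "(\<mu>, \<nu>) \<in> rel_equiv A"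
  shows "tight A \<mu> \<longleftrightarrow> tight A \<nu>"
proof -
  have "emeasure \<mu> E = emeasure \<nu> E" if "E \<in> sets borel" "E \<subseteq> - A" for E
    using assms that by (simp add: rel_equiv_iff)
  moreover have "(SUP K\<in>{K. compact K \<and> K \<subseteq> E}. emeasure \<mu> K) =
      (SUP K\<in>{K. compact K \<and> K \<subseteq> E}. emeasure \<nu> K)" if "E \<subseteq> - A" for E
    using calculation that by (intro SUP_cong) (auto simp: borel_compact)
  ultimately show ?thesis unfolding tight_def by simp
qed

lemma p_finite_rel_equiv:
  assumes "closed A" "(\<mu>, \<nu>) \<in> rel_equiv A"
  shows "p_finite A p \<mu> \<longleftrightarrow> p_finite A p \<nu>"
proof -
  have mn: "sets \<mu> = sets borel" "sets \<nu> = sets borel" and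
    eq: "\<And>E. \<lbrakk>E \<in> sets borel; E \<subseteq> - A\<rbrakk> \<Longrightarrow> emeasure \<mu> E = emeasure \<nu> E"
    using assms by (auto simp: rel_equiv_iff borel_measures_def)
  have Ab: "- A \<in> sets borel" using assms by auto
  have "emeasure \<mu> {x. infdist x A > e} = emeasure \<nu> {x. infdist x A > e}" if "e > 0" for e
  proof (rule eq)
    have "open {x. infdist x A > e}" by (intro open_Collect_less continuous_intros)
    then show "{x. infdist x A > e} \<in> sets borel" by simp
    show "{x. infdist x A > e} \<subseteq> - A" using that by auto
  qed
  moreover have "(\<integral>\<^sup>+x\<in>- A. f x \<partial>\<mu>) = (\<integral>\<^sup>+x\<in>- A. f x \<partial>\<nu>)" for f
  proof -
    have "restrict_space \<mu> (- A) = restrict_space \<nu> (- A)"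
    proof (rule measure_eqI)
      show "sets (restrict_space \<mu> (- A)) = sets (restrict_space \<nu> (- A))"
        using mn by (simp add: sets_restrict_space)
      fix E assume "E \<in> sets (restrict_space \<mu> (- A))"
      then have "E \<in> sets borel" "E \<subseteq> - A"
        using mn Ab by (auto simp: sets_restrict_space)
      then show "emeasure (restrict_space \<mu> (- A)) E = emeasure (restrict_space \<nu> (- A)) E"
        using mn Ab eq by (simp add: emeasure_restrict_space)
    qed
    moreover have "(\<integral>\<^sup>+x\<in>- A. f x \<partial>\<rho>) = (\<integral>\<^sup>+x. f x \<partial>restrict_space \<rho> (- A))"
      if "sets \<rho> = sets borel" for \<rho>
      using that Ab by (subst nn_integral_restrict_space) simp_all
    ultimately show ?thesis using mn by simp
  qed
  ultimately show ?thesis unfolding p_finite_def by auto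
qed

lemma locally_p_finite_rel_equiv:
  assumes "closed A" "(\<mu>, \<nu>) \<in> rel_equiv A"
  shows "locally_p_finite A p \<mu> \<longleftrightarrow> locally_p_finite A p \<nu>"
proof -
  have "p_finite A p (density \<mu> (indicator U)) \<longleftrightarrow> p_finite A p (density \<nu> (indicator U))"
    if U: "U \<in> sets borel" for U
  proof (rule p_finite_rel_equiv)
    have "emeasure (density \<rho> (indicator U)) E = emeasure \<rho> (U \<inter> E)"
      if "sets \<rho> = sets borel" "E \<in> sets borel" for \<rho> :: "'a measure" and E
      using that U by (simp add: emeasure_density indicator_inter_arith[symmetric])
    moreover have "U \<inter> E \<in> sets borel" "U \<inter> E \<subseteq> - A"
      if "E \<in> sets borel" "E \<subseteq> - A" for E using that U by auto
    ultimately show "(density \<mu> (indicator U), density \<nu> (indicator U)) \<in> rel_equiv A"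
      using assms by (simp add: rel_equiv_iff borel_measures_def)
  qed (rule assms)
  then show ?thesis unfolding locally_p_finite_def by simp
qed

end

theory Submission
  imports Defs
begin

text \<open>A locally \<open>p\<close>-finite measure is finite on compact sets off \<open>A\<close>, and a tight one is determined
  by its values there, so addition is cancellative and the natural order is the setwise order: the
  complement \<open>\<nu> - \<mu>\<close> is computed on sets of finite \<open>\<nu>\<close>-measure. The join is the supremum of measures
  \<open>E \<mapsto> sup {\<mu> (E \<inter> Y) + \<nu> (E - Y)}\<close>. Being dominated by a finite multiple of \<open>\<mu> + \<nu>\<close> off \<open>A\<close>
  preserves (local) \<open>p\<close>-finiteness, which covers sums, multiples, joins and smaller measures at once.\<close>

text \<open>The natural order asks for a complement inside the cone, whereas joins and ideals are
  accessible only through inequalities between values. The obstacle is thus to find, for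
  \<open>\<mu>\<close> below \<open>\<nu>\<close>, a complement that is again a tight measure. The
  formula \<open>emeasure \<nu> E - emeasure \<mu> E\<close> is not additive: with both equal to
  Lebesgue measure on the line it is 0 on bounded sets, but \<infinity> - \<infinity> = \<infinity>
  in \<open>ennreal\<close> on the whole line. Subtraction is safe where \<open>\<nu>\<close> is
  finite, and suprema over such sets do form a measure. That nothing is lost in the supremum rests
  on tightness: a \<open>\<nu>\<close> with values 0 and \<infinity> only would differ from the zero
  measure by 0. The hypothesis \<open>A \<noteq> {}\<close> enters through the positivity of
  \<open>infdist _ A\<close> off \<open>A\<close>, since \<open>infdist _ {}\<close> is 0. Joins
  need no finiteness: the supremum of two measures and its compatibility with sums are available for
  all Borel measures and pass to classes.\<close>

lemma SUP_add_SUP_le_ennreal: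
  fixes f :: "'i \<Rightarrow> ennreal" and g :: "'j \<Rightarrow> ennreal"
  assumes "I \<noteq> {}" "J \<noteq> {}" and le: "\<And>i j. i \<in> I \<Longrightarrow> j \<in> J \<Longrightarrow> f i + g j \<le> c"
  shows "(SUP i\<in>I. f i) + (SUP j\<in>J. g j) \<le> c"
  unfolding ennreal_SUP_add_left[OF assms(1), symmetric] ennreal_SUP_add_right[OF assms(2)]
  by (intro SUP_least le)

section \<open>Arithmetic of Borel measures\<close>

lemma add_measure_borel [simp]: "add_measure \<mu> \<nu> \<in> borel_measures"
  by (simp add: borel_measures_def)

lemma scale_measure_borel [simp]: "\<mu> \<in> borel_measures \<Longrightarrow> scale_measure r \<mu> \<in> borel_measures"
  by (simp add: borel_measures_def)

lemma null_measure_borel [simp]: "null_measure borel \<in> borel_measures"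
  by (simp add: borel_measures_def)

lemma sup_measure'_borel [simp]:
  "\<mu> \<in> borel_measures \<Longrightarrow> \<nu> \<in> borel_measures \<Longrightarrow> sup_measure' \<mu> \<nu> \<in> borel_measures"
  by (simp add: borel_measures_def)

lemma density_borel [simp]: "\<mu> \<in> borel_measures \<Longrightarrow> density \<mu> f \<in> borel_measures"
  by (simp add: borel_measures_def)

lemma sets_borel_measures [simp]: "\<mu> \<in> borel_measures \<Longrightarrow> sets \<mu> = sets borel"
  by (simp add: borel_measures_def)

lemma space_borel_measures [simp]: "\<mu> \<in> borel_measures \<Longrightarrow> space \<mu> = UNIV"
  by (metis sets_borel_measures sets_eq_imp_space_eq space_borel)

lemma emeasure_density_indicator:
  assumes "\<mu> \<in> borel_measures" "U \<in> sets borel" "E \<in> sets borel"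
  shows "emeasure (density \<mu> (indicator U)) E = emeasure \<mu> (U \<inter> E)"
proof -
  have "sets \<mu> = sets borel" using assms by simp
  then show ?thesis
    using assms(2,3) by (simp add: emeasure_density indicator_inter_arith[symmetric])
qed

lemma emeasure_borel_mono:
  "\<mu> \<in> borel_measures \<Longrightarrow> E \<subseteq> F \<Longrightarrow> F \<in> sets borel \<Longrightarrow> emeasure \<mu> E \<le> emeasure \<mu> F"
  by (simp add: emeasure_mono)

lemma add_measure_commute: "add_measure \<mu> \<nu> = add_measure \<nu> \<mu>"
  by (simp add: add_measure_def add.commute)

lemma add_measure_assoc:
  assumes "\<mu> \<in> borel_measures" "\<nu> \<in> borel_measures" "\<rho> \<in> borel_measures"
  shows "add_measure (add_measure \<mu> \<nu>) \<rho> = add_measure \<mu> (add_measure \<nu> \<rho>)"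
  by (rule measure_eqI) (simp_all add: assms emeasure_add_measure add.assoc)

lemma add_null_measure:
  "\<mu> \<in> borel_measures \<Longrightarrow> add_measure (null_measure borel) \<mu> = \<mu>"
  by (rule measure_eqI) (simp_all add: emeasure_add_measure)

lemma scale_add_measure:
  assumes "\<mu> \<in> borel_measures" "\<nu> \<in> borel_measures"
  shows "scale_measure r (add_measure \<mu> \<nu>) = add_measure (scale_measure r \<mu>) (scale_measure r \<nu>)"
  by (rule measure_eqI) (simp_all add: assms emeasure_add_measure distrib_left)

lemma scale_measure_add:
  assumes "\<mu> \<in> borel_measures"
  shows "scale_measure (r + s) \<mu> = add_measure (scale_measure r \<mu>) (scale_measure s \<mu>)"
  by (rule measure_eqI) (simp_all add: assms emeasure_add_measure distrib_right)

lemma scale_measure_mult: "scale_measure (r * s) \<mu> = scale_measure r (scale_measure s \<mu>)"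
  by (rule measure_eqI) (simp_all add: mult.assoc)

lemma scale_measure_zero: "\<mu> \<in> borel_measures \<Longrightarrow> scale_measure 0 \<mu> = null_measure borel"
  by (rule measure_eqI) simp_all

lemma scale_null_measure: "scale_measure r (null_measure M) = null_measure M"
  by (rule measure_eqI) simp_all

section \<open>Tightness\<close>

lemma tightI:
  fixes A :: "'a::metric_space set"
  assumes "\<mu> \<in> borel_measures"
    and "\<And>E. E \<in> sets borel \<Longrightarrow> E \<subseteq> - A \<Longrightarrow>
      emeasure \<mu> E \<le> (SUP K\<in>{K. compact K \<and> K \<subseteq> E}. emeasure \<mu> K)"
  shows "tight A \<mu>"
  unfolding tight_def
  using assms by (auto intro!: antisym SUP_least emeasure_borel_mono)

lemma tightD:
  "tight A \<mu> \<Longrightarrow> E \<in> sets borel \<Longrightarrow> E \<subseteq> - A \<Longrightarrow>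
    emeasure \<mu> E = (SUP K\<in>{K. compact K \<and> K \<subseteq> E}. emeasure \<mu> K)"
  by (simp add: tight_def)

lemma compact_subsets_nonempty: "{K. compact K \<and> K \<subseteq> E} \<noteq> {}"
  by (auto intro: exI[of _ "{}"])

text \<open>The compact sets approximating \<open>\<mu>\<close> and \<open>\<nu>\<close> are chosen
  independently; by monotonicity their union serves both measures.\<close>

lemma tight_add_measure:
  fixes A :: "'a::metric_space set"
  assumes b: "\<mu> \<in> borel_measures" "\<nu> \<in> borel_measures" and t: "tight A \<mu>" "tight A \<nu>"
  shows "tight A (add_measure \<mu> \<nu>)"
proof (rule tightI)
  fix E :: "'a set"
  assume E: "E \<in> sets borel" "E \<subseteq> - A"
  have "emeasure \<mu> K + emeasure \<nu> L \<le>
      (SUP K\<in>{K. compact K \<and> K \<subseteq> E}. emeasure (add_measure \<mu> \<nu>) K)"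
    if "compact K \<and> K \<subseteq> E" "compact L \<and> L \<subseteq> E" for K L
  proof (rule SUP_upper2[of "K \<union> L"])
    show "emeasure \<mu> K + emeasure \<nu> L \<le> emeasure (add_measure \<mu> \<nu>) (K \<union> L)"
      using b borel_compact[of K] borel_compact[of L] that
      by (subst emeasure_add_measure) (auto intro!: add_mono emeasure_borel_mono)
  qed (use that in auto)
  then show "emeasure (add_measure \<mu> \<nu>) E \<le>
      (SUP K\<in>{K. compact K \<and> K \<subseteq> E}. emeasure (add_measure \<mu> \<nu>) K)"
    unfolding emeasure_add_measure[OF b E(1)] tightD[OF t(1) E] tightD[OF t(2) E]
    by (intro SUP_add_SUP_le_ennreal compact_subsets_nonempty) auto
qed simp

lemma tight_scale_measure:
  fixes A :: "'a::metric_space set"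
  assumes "tight A \<mu>"
  shows "tight A (scale_measure r \<mu>)"
  using assms by (simp add: tight_def SUP_mult_left_ennreal)

text \<open>For a fixed splitting set \<open>Y\<close>, the two halves of \<open>E\<close> are
  approximated from inside by compact sets \<open>K\<close> and \<open>L\<close>. Their union is the
  compact set at which the supremum measure is evaluated, with a splitting set other than
  \<open>Y\<close>.\<close>

lemma tight_sup_measure':
  fixes A :: "'a::metric_space set"
  assumes b: "\<mu> \<in> borel_measures" "\<nu> \<in> borel_measures" and t: "tight A \<mu>" "tight A \<nu>"
  shows "tight A (sup_measure' \<mu> \<nu>)"
proof (rule tightI)
  fix E :: "'a set"
  assume E: "E \<in> sets borel" "E \<subseteq> - A"
  have "emeasure \<mu> (E \<inter> Y) + emeasure \<nu> (E \<inter> - Y) \<le>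
      (SUP K\<in>{K. compact K \<and> K \<subseteq> E}. emeasure (sup_measure' \<mu> \<nu>) K)"
    if Y: "Y \<in> sets borel" for Y
  proof -
    have EY: "E \<inter> Y \<in> sets borel" "E \<inter> Y \<subseteq> - A" "E \<inter> - Y \<in> sets borel" "E \<inter> - Y \<subseteq> - A"
      using E Y by auto
    have "emeasure \<mu> K + emeasure \<nu> L \<le>
        (SUP K\<in>{K. compact K \<and> K \<subseteq> E}. emeasure (sup_measure' \<mu> \<nu>) K)"
      if KL: "compact K \<and> K \<subseteq> E \<inter> Y" "compact L \<and> L \<subseteq> E \<inter> - Y" for K L
    proof (rule SUP_upper2[of "K \<union> L"])
      have KLb: "K \<in> sets borel" "L \<in> sets borel"
        using KL by (auto simp: borel_compact)
      \<comment> \<open>\<open>K\<close> and \<open>L\<close> are disjoint, so \<open>K\<close>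
        itself splits \<open>K \<union> L\<close> into \<open>K\<close> and
        \<open>L\<close>.\<close>
      have "emeasure \<mu> K + emeasure \<nu> L =
          emeasure \<mu> ((K \<union> L) \<inter> K) + emeasure \<nu> ((K \<union> L) \<inter> - K)"
        using KL by (intro arg_cong2[where f = "(+)"] arg_cong2[where f = emeasure]) auto
      also have "\<dots> \<le>
          (SUP Y\<in>sets borel. emeasure \<mu> ((K \<union> L) \<inter> Y) + emeasure \<nu> ((K \<union> L) \<inter> - Y))"
        by (rule SUP_upper2[OF KLb(1)]) simp
      also have "\<dots> = emeasure (sup_measure' \<mu> \<nu>) (K \<union> L)"
        using b KLb by (subst emeasure_sup_measure') auto
      finally show "emeasure \<mu> K + emeasure \<nu> L \<le> emeasure (sup_measure' \<mu> \<nu>) (K \<union> L)" .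
    qed (use KL in auto)
    then show ?thesis
      unfolding tightD[OF t(1) EY(1,2)] tightD[OF t(2) EY(3,4)]
      by (intro SUP_add_SUP_le_ennreal compact_subsets_nonempty) auto
  qed
  then show "emeasure (sup_measure' \<mu> \<nu>) E \<le>
      (SUP K\<in>{K. compact K \<and> K \<subseteq> E}. emeasure (sup_measure' \<mu> \<nu>) K)"
    using b E by (subst emeasure_sup_measure') (auto intro!: SUP_least)
qed (use b in simp)

lemma emeasure_sup_measure'_le_add:
  assumes b: "\<mu> \<in> borel_measures" "\<nu> \<in> borel_measures" and E: "E \<in> sets borel"
  shows "emeasure (sup_measure' \<mu> \<nu>) E \<le> emeasure \<mu> E + emeasure \<nu> E"
  using b E by (subst emeasure_sup_measure') (auto intro!: SUP_least add_mono emeasure_borel_mono)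

text \<open>Whatever the splitting set, \<open>\<rho>\<close> contributes the constant
  \<open>emeasure \<rho> E\<close>, which therefore leaves the supremum, even when it is
  infinite.\<close>

lemma sup_measure'_add_right:
  fixes \<mu> \<nu> \<rho> :: "'a::metric_space measure"
  assumes b: "\<mu> \<in> borel_measures" "\<nu> \<in> borel_measures" "\<rho> \<in> borel_measures"
  shows "sup_measure' (add_measure \<mu> \<rho>) (add_measure \<nu> \<rho>) = add_measure (sup_measure' \<mu> \<nu>) \<rho>"
proof (rule measure_eqI)
  fix E assume "E \<in> sets (sup_measure' (add_measure \<mu> \<rho>) (add_measure \<nu> \<rho>))"
  then have E: "E \<in> sets borel" by simp
  have split: "emeasure (add_measure \<mu> \<rho>) (E \<inter> Y) + emeasure (add_measure \<nu> \<rho>) (E \<inter> - Y) =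
      emeasure \<mu> (E \<inter> Y) + emeasure \<nu> (E \<inter> - Y) + emeasure \<rho> E" if "Y \<in> sets borel" for Y
  proof -
    have "emeasure \<rho> E = emeasure \<rho> (E \<inter> Y) + emeasure \<rho> (E \<inter> - Y)"
      using E b that by (subst plus_emeasure) (auto intro!: arg_cong[where f = "emeasure \<rho>"])
    then show ?thesis using b E that by (simp add: emeasure_add_measure ac_simps)
  qed
  have "emeasure (sup_measure' (add_measure \<mu> \<rho>) (add_measure \<nu> \<rho>)) E =
      (SUP Y\<in>sets borel. emeasure (add_measure \<mu> \<rho>) (E \<inter> Y) + emeasure (add_measure \<nu> \<rho>) (E \<inter> - Y))"
    using E by (subst emeasure_sup_measure') auto
  also have "\<dots> = (SUP Y\<in>sets borel. emeasure \<mu> (E \<inter> Y) + emeasure \<nu> (E \<inter> - Y) + emeasure \<rho> E)"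
    using split by (intro SUP_cong) auto
  also have "\<dots> = (SUP Y\<in>sets borel. emeasure \<mu> (E \<inter> Y) + emeasure \<nu> (E \<inter> - Y)) + emeasure \<rho> E"
    by (intro ennreal_SUP_add_left) auto
  also have "\<dots> = emeasure (add_measure (sup_measure' \<mu> \<nu>) \<rho>) E"
    using b E by (simp add: emeasure_add_measure emeasure_sup_measure')
  finally show "emeasure (sup_measure' (add_measure \<mu> \<rho>) (add_measure \<nu> \<rho>)) E =
      emeasure (add_measure (sup_measure' \<mu> \<nu>) \<rho>) E" .
qed simp

section \<open>Dominated measures and finiteness\<close>

text \<open>The integral is a supremum over simple functions, and being simple depends only on the
  sigma-algebra. The same \<open>g\<close> therefore competes for all three measures, and its
  integrals are compared level set by level set.\<close>

lemma set_nn_integral_dominated: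
  fixes f :: "'a::metric_space \<Rightarrow> ennreal"
  assumes b: "\<mu> \<in> borel_measures" "\<nu> \<in> borel_measures" "\<rho> \<in> borel_measures" and B: "B \<in> sets borel"
    and le: "\<And>E. E \<in> sets borel \<Longrightarrow> E \<subseteq> B \<Longrightarrow> emeasure \<rho> E \<le> c * (emeasure \<mu> E + emeasure \<nu> E)"
  shows "(\<integral>\<^sup>+x\<in>B. f x \<partial>\<rho>) \<le> c * ((\<integral>\<^sup>+x\<in>B. f x \<partial>\<mu>) + (\<integral>\<^sup>+x\<in>B. f x \<partial>\<nu>))"
  unfolding nn_integral_def[of \<rho>]
proof (rule SUP_least)
  fix g assume "g \<in> {g. simple_function \<rho> g \<and> g \<le> (\<lambda>x. f x * indicator B x)}"
  then have g: "simple_function \<rho> g" and gf: "g \<le> (\<lambda>x. f x * indicator B x)" by auto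
  have g': "simple_function \<mu> g" "simple_function \<nu> g"
    using g b by (simp_all add: simple_function_def)
  have fin: "finite (range g)" and meas: "\<And>y. g -` {y} \<in> sets borel"
    using b simple_functionD(1)[OF g] simple_functionD(2)[OF g, of "{y}" for y] by auto
  have "y * emeasure \<rho> (g -` {y}) \<le> y * (c * (emeasure \<mu> (g -` {y}) + emeasure \<nu> (g -` {y})))" for y
  proof (cases "y = 0")
    case False
    \<comment> \<open>Domination is known only inside \<open>B\<close>; outside it the bound on
      \<open>g\<close> is 0, so nonzero level sets lie in \<open>B\<close>.\<close>
    have "g -` {y} \<subseteq> B"
    proof
      fix x assume "x \<in> g -` {y}"
      then show "x \<in> B" using False le_funD[OF gf, of x] by (cases "x \<in> B") auto
    qed
    then show ?thesis using le meas by (intro mult_left_mono) auto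
  qed simp
  then have "integral\<^sup>S \<rho> g \<le>
      (\<Sum>y\<in>range g. y * (c * (emeasure \<mu> (g -` {y}) + emeasure \<nu> (g -` {y}))))"
    using b by (auto simp: simple_integral_def intro!: sum_mono)
  also have "\<dots> = c * (integral\<^sup>S \<mu> g + integral\<^sup>S \<nu> g)"
    using b by (simp add: simple_integral_def sum_distrib_left sum.distrib[symmetric] algebra_simps)
  also have "\<dots> \<le> c * ((\<integral>\<^sup>+x\<in>B. f x \<partial>\<mu>) + (\<integral>\<^sup>+x\<in>B. f x \<partial>\<nu>))"
    using g' gf unfolding nn_integral_def by (intro mult_left_mono add_mono SUP_upper) auto
  finally show "integral\<^sup>S \<rho> g \<le> c * ((\<integral>\<^sup>+x\<in>B. f x \<partial>\<mu>) + (\<integral>\<^sup>+x\<in>B. f x \<partial>\<nu>))" .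
qed

lemma infdist_superlevel_borel: "{x. infdist x A > e} \<in> sets borel"
  by (intro borel_open open_Collect_less continuous_intros)

lemma p_finite_dominated:
  fixes A :: "'a::metric_space set"
  assumes A: "closed A" and b: "\<mu> \<in> borel_measures" "\<nu> \<in> borel_measures" "\<rho> \<in> borel_measures"
    and c: "c < \<infinity>"
    and le: "\<And>E. E \<in> sets borel \<Longrightarrow> E \<subseteq> - A \<Longrightarrow> emeasure \<rho> E \<le> c * (emeasure \<mu> E + emeasure \<nu> E)"
    and fin: "p_finite A p \<mu>" "p_finite A p \<nu>"
  shows "p_finite A p \<rho>"
proof (cases "p = \<infinity>")
  case True
  \<comment> \<open>\<open>infdist _ A\<close> vanishes on \<open>A\<close>, so superlevel sets for
    positive \<open>e\<close> lie off \<open>A\<close>, where domination applies.\<close>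
  have le': "emeasure \<rho> {x. infdist x A > e} \<le>
      c * (emeasure \<mu> {x. infdist x A > e} + emeasure \<nu> {x. infdist x A > e})" if "e > 0" for e
    using that by (intro le infdist_superlevel_borel) auto
  obtain d1 d2 where d: "d1 > 0" "d2 > 0" "emeasure \<mu> {x. infdist x A > d1} = 0"
      "emeasure \<nu> {x. infdist x A > d2} = 0"
    using fin True by (auto simp: p_finite_def)
  \<comment> \<open>Superlevel sets shrink as the threshold grows, so \<open>max d1 d2\<close>
    serves both measures.\<close>
  have "emeasure \<mu> {x. infdist x A > max d1 d2} \<le> emeasure \<mu> {x. infdist x A > d1}"
    "emeasure \<nu> {x. infdist x A > max d1 d2} \<le> emeasure \<nu> {x. infdist x A > d2}"
    by (auto intro!: emeasure_borel_mono b infdist_superlevel_borel)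
  then have "emeasure \<rho> {x. infdist x A > max d1 d2} = 0"
    using le'[of "max d1 d2"] d by simp
  moreover have "emeasure \<rho> {x. infdist x A > e} < \<infinity>" if "e > 0" for e
    using that fin True c le'[OF that]
    by (auto simp: p_finite_def ennreal_mult_less_top intro: le_less_trans)
  ultimately show ?thesis
    using d True unfolding p_finite_def by (auto intro!: exI[of _ "max d1 d2"])
next
  case False
  let ?I = "\<lambda>\<mu>. \<integral>\<^sup>+x\<in>- A. ennreal (infdist x A powr enn2real p) \<partial>\<mu>"
  have "?I \<rho> \<le> c * (?I \<mu> + ?I \<nu>)"
    using A by (intro set_nn_integral_dominated b le) auto
  also have "\<dots> < \<infinity>"
    using fin c False by (simp add: p_finite_def ennreal_mult_less_top)
  finally show ?thesis using False by (simp add: p_finite_def)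
qed

text \<open>Neighborhoods for \<open>\<mu>\<close> and \<open>\<nu>\<close> may differ. On their
  intersection domination is inherited, since it is tested on
  \<open>U \<inter> V \<inter> E\<close>, still a Borel set off \<open>A\<close>.\<close>

lemma locally_p_finite_dominated:
  fixes A :: "'a::metric_space set"
  assumes A: "closed A" and b: "\<mu> \<in> borel_measures" "\<nu> \<in> borel_measures" "\<rho> \<in> borel_measures"
    and c: "c < \<infinity>"
    and le: "\<And>E. E \<in> sets borel \<Longrightarrow> E \<subseteq> - A \<Longrightarrow> emeasure \<rho> E \<le> c * (emeasure \<mu> E + emeasure \<nu> E)"
    and fin: "locally_p_finite A p \<mu>" "locally_p_finite A p \<nu>"
  shows "locally_p_finite A p \<rho>"
  unfolding locally_p_finite_def
proof
  fix x
  obtain U V where U: "U \<in> sets borel" "x \<in> interior U" "p_finite A p (density \<mu> (indicator U))"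
    and V: "V \<in> sets borel" "x \<in> interior V" "p_finite A p (density \<nu> (indicator V))"
    using fin unfolding locally_p_finite_def by blast
  have "p_finite A p (density \<rho> (indicator (U \<inter> V)))"
  proof (rule p_finite_dominated[OF A _ _ _ c _ U(3) V(3)])
    fix E :: "'a set"
    assume E: "E \<in> sets borel" "E \<subseteq> - A"
    have "emeasure \<rho> (U \<inter> V \<inter> E) \<le> c * (emeasure \<mu> (U \<inter> V \<inter> E) + emeasure \<nu> (U \<inter> V \<inter> E))"
      using E U V by (intro le) auto
    also have "\<dots> \<le> c * (emeasure \<mu> (U \<inter> E) + emeasure \<nu> (V \<inter> E))"
      using E U V b by (intro mult_left_mono add_mono emeasure_borel_mono) auto
    finally show "emeasure (density \<rho> (indicator (U \<inter> V))) E \<le>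
        c * (emeasure (density \<mu> (indicator U)) E + emeasure (density \<nu> (indicator V)) E)"
      using E U V b by (simp add: emeasure_density_indicator)
  qed (use b in auto)
  then show "\<exists>U\<in>sets borel. x \<in> interior U \<and> p_finite A p (density \<rho> (indicator U))"
    using U V by (intro bexI[of _ "U \<inter> V"]) auto
qed

lemma p_finite_imp_locally_p_finite:
  assumes "\<mu> \<in> borel_measures" "p_finite A p \<mu>"
  shows "locally_p_finite A p \<mu>"
proof -
  have "density \<mu> (indicator UNIV) = \<mu>"
    by (simp add: density_1)
  then show ?thesis
    using assms unfolding locally_p_finite_def by (auto intro!: bexI[of _ UNIV])
qed

lemma p_finite_null_measure: "p_finite A p (null_measure borel)"
  by (auto simp: p_finite_def intro: exI[of _ 1])

text \<open>Off \<open>A\<close> the function \<open>infdist _ A\<close> is bounded below on compact sets, so local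
  \<open>p\<close>-finiteness becomes local finiteness there.\<close>

lemma emeasure_compact_finite:
  fixes A :: "'a::metric_space set"
  assumes A: "closed A" "A \<noteq> {}" and b: "\<mu> \<in> borel_measures" and loc: "locally_p_finite A p \<mu>"
    and K: "compact K" "K \<subseteq> - A"
  shows "emeasure \<mu> K < \<infinity>"
proof (cases "K = {}")
  case False
  have Kb: "K \<in> sets borel" using K by (simp add: borel_compact)
  obtain y where y: "y \<in> K" "\<And>x. x \<in> K \<Longrightarrow> infdist y A \<le> infdist x A"
    using continuous_attains_inf[OF K(1) False continuous_on_infdist[OF continuous_on_id]] by blast
  define m where "m = infdist y A"
  have m: "m > 0" using y K A by (auto simp: m_def intro!: infdist_pos_not_in_closed)
  have fin: "emeasure \<mu> (U \<inter> K) < \<infinity>"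
    if U: "U \<in> sets borel" "p_finite A p (density \<mu> (indicator U))" for U
  proof (cases "p = \<infinity>")
    case True
    \<comment> \<open>Superlevel sets are strict and the minimum \<open>m\<close> is attained on
      \<open>K\<close>, hence the threshold \<open>m / 2\<close> instead of
      \<open>m\<close>.\<close>
    have "emeasure \<mu> (U \<inter> K) \<le> emeasure \<mu> (U \<inter> {x. infdist x A > m / 2})"
      using y m U(1) b infdist_superlevel_borel[of "m / 2" A]
      by (intro emeasure_borel_mono) (force simp: m_def)+
    also have "\<dots> = emeasure (density \<mu> (indicator U)) {x. infdist x A > m / 2}"
      by (rule emeasure_density_indicator[OF b U(1) infdist_superlevel_borel, symmetric])
    also have "\<dots> < \<infinity>"
    proof -
      have "\<forall>e>0. emeasure (density \<mu> (indicator U)) {x. infdist x A > e} < \<infinity>"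
        using U(2) True by (simp add: p_finite_def)
      then show ?thesis using half_gt_zero[OF m] by blast
    qed
    finally show ?thesis .
  next
    case False
    let ?c = "ennreal (m powr enn2real p)" and ?\<rho> = "density \<mu> (indicator U)"
    \<comment> \<open>Chebyshev's inequality on \<open>K\<close>. As \<open>m > 0\<close>, the
      constant \<open>?c\<close> is positive, also for \<open>p = 0\<close>, where it is 1.\<close>
    have "?c * emeasure ?\<rho> K = (\<integral>\<^sup>+x. ?c * indicator K x \<partial>?\<rho>)"
      using b Kb by (simp add: nn_integral_cmult_indicator)
    also have "\<dots> \<le> (\<integral>\<^sup>+x\<in>- A. ennreal (infdist x A powr enn2real p) \<partial>?\<rho>)"
    proof (rule nn_integral_mono)
      fix x
      show "?c * indicator K x \<le> ennreal (infdist x A powr enn2real p) * indicator (- A) x"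
        using y m K by (auto simp: indicator_def m_def intro!: ennreal_leI powr_mono2)
    qed
    also have "\<dots> < \<infinity>" using U False by (simp add: p_finite_def)
    finally have "emeasure ?\<rho> K < \<infinity>"
      using m by (auto simp: ennreal_mult_less_top)
    then show ?thesis using U b Kb by (simp add: emeasure_density_indicator)
  qed
  obtain U where U: "\<And>x. U x \<in> sets borel" "\<And>x. x \<in> interior (U x)"
    "\<And>x. p_finite A p (density \<mu> (indicator (U x)))"
    using loc unfolding locally_p_finite_def by metis
  obtain F where F: "finite F" "K \<subseteq> (\<Union>x\<in>F. interior (U x))"
    by (rule compactE_image[OF K(1), of K "\<lambda>x. interior (U x)"]) (use U(2) in auto)
  have "emeasure \<mu> K \<le> emeasure \<mu> (\<Union>x\<in>F. U x \<inter> K)"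
    using F U(1) Kb interior_subset b by (intro emeasure_borel_mono sets.finite_UN) (auto, blast)
  also have "\<dots> \<le> (\<Sum>x\<in>F. emeasure \<mu> (U x \<inter> K))"
    using F U Kb b by (intro emeasure_subadditive_finite) auto
  also have "\<dots> < \<infinity>" using F fin[OF U(1,3)] by simp
  finally show ?thesis .
qed simp


section \<open>Differences of measures\<close>

text \<open>Measures in the cone need not be \<open>\<sigma>\<close>-finite, so \<open>\<nu> - \<mu>\<close> is defined on sets of finite
  \<open>\<nu>\<close>-measure and extended by suprema.\<close>

definition difference_measure ::
    "'a::metric_space set \<Rightarrow> 'a measure \<Rightarrow> 'a measure \<Rightarrow> 'a measure" where
  "difference_measure A \<mu> \<nu> = measure_of UNIV (sets borel)
     (\<lambda>E. SUP F\<in>{F \<in> sets borel. F \<subseteq> E - A \<and> emeasure \<nu> F < \<infinity>}. emeasure \<nu> F - emeasure \<mu> F)"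

lemma difference_measure_borel [simp]: "difference_measure A \<mu> \<nu> \<in> borel_measures"
  unfolding borel_measures_def difference_measure_def
  by (simp add: sets.sets_measure_of_eq[of borel, simplified])

locale dominated_measures =
  fixes A :: "'a::metric_space set" and \<mu> \<nu> :: "'a measure"
  assumes closed: "closed A" and borel: "\<mu> \<in> borel_measures" "\<nu> \<in> borel_measures"
    and dominated: "\<And>E. E \<in> sets borel \<Longrightarrow> E \<subseteq> - A \<Longrightarrow> emeasure \<mu> E \<le> emeasure \<nu> E"
begin

text \<open>\<open>A\<close> is cut out because domination holds only off \<open>A\<close>; the
  difference measure consequently vanishes on subsets of \<open>A\<close>.\<close>

abbreviation finite_part :: "'a set \<Rightarrow> 'a set set" where
  "finite_part E \<equiv> {F \<in> sets borel. F \<subseteq> E - A \<and> emeasure \<nu> F < \<infinity>}"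

abbreviation gap :: "'a set \<Rightarrow> ennreal" where
  "gap F \<equiv> emeasure \<nu> F - emeasure \<mu> F"

lemma emeasure_add_gap:
  assumes "F \<in> finite_part E"
  shows "emeasure \<mu> F + gap F = emeasure \<nu> F"
proof -
  have "emeasure \<mu> F \<le> emeasure \<nu> F" using assms by (intro dominated) auto
  then show ?thesis by (metis add.commute diff_add_cancel_ennreal)
qed

text \<open>Finite \<open>emeasure \<nu> F\<close> makes \<open>emeasure \<mu> F\<close> finite,
  hence cancellable. Identities between gaps can thus be proved by adding \<open>\<mu>\<close> back
  instead of computing with truncated subtraction.\<close>

lemma gap_eqI:
  assumes "F \<in> finite_part E" "emeasure \<mu> F + s = emeasure \<nu> F"
  shows "gap F = s"
proof -
  have "emeasure \<mu> F + s \<noteq> \<infinity>" unfolding assms(2) using assms(1) by (simp add: less_top)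
  then show ?thesis unfolding assms(2)[symmetric] by simp
qed

lemma gap_Un:
  assumes F: "F \<in> finite_part E" and G: "G \<in> finite_part E'" and "F \<inter> G = {}"
  shows "gap F + gap G = gap (F \<union> G)" and "F \<union> G \<in> finite_part (E \<union> E')"
proof -
  have un: "emeasure \<rho> (F \<union> G) = emeasure \<rho> F + emeasure \<rho> G" if "\<rho> \<in> borel_measures" for \<rho> :: "'a measure"
    using assms that by (intro plus_emeasure[symmetric]) auto
  show FG: "F \<union> G \<in> finite_part (E \<union> E')"
    using F G un[OF borel(2)] by auto
  show "gap F + gap G = gap (F \<union> G)"
  proof (rule gap_eqI[OF FG, symmetric])
    have "emeasure \<mu> (F \<union> G) + (gap F + gap G) = (emeasure \<mu> F + gap F) + (emeasure \<mu> G + gap G)"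
      unfolding un[OF borel(1)] by (simp only: ac_simps)
    then show "emeasure \<mu> (F \<union> G) + (gap F + gap G) = emeasure \<nu> (F \<union> G)"
      unfolding emeasure_add_gap[OF F] emeasure_add_gap[OF G] un[OF borel(2)] .
  qed
qed

lemma finite_part_nonempty: "finite_part E \<noteq> {}"
proof -
  have "{} \<in> finite_part E" by simp
  then show ?thesis by blast
qed

text \<open>Disjoint finite pieces of \<open>E\<close> and \<open>E'\<close> unite to a finite piece
  of the union. Only this inequality is needed here; the opposite one is proved for countable unions
  directly.\<close>

lemma SUP_gap_superadditive:
  assumes "E \<inter> E' = {}"
  shows "(SUP F\<in>finite_part E. gap F) + (SUP F\<in>finite_part E'. gap F) \<le>
    (SUP F\<in>finite_part (E \<union> E'). gap F)"
proof (rule SUP_add_SUP_le_ennreal[OF finite_part_nonempty finite_part_nonempty])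
  fix F G assume F: "F \<in> finite_part E" and G: "G \<in> finite_part E'"
  have "F \<inter> G = {}" using F G assms by auto
  then show "gap F + gap G \<le> (SUP F\<in>finite_part (E \<union> E'). gap F)"
    unfolding gap_Un(1)[OF F G \<open>F \<inter> G = {}\<close>]
    by (intro SUP_upper gap_Un(2)[OF F G])
qed

lemma SUP_gap_sum_le:
  fixes E :: "nat \<Rightarrow> 'a set"
  assumes "disjoint_family E"
  shows "(\<Sum>i<n. SUP F\<in>finite_part (E i). gap F) \<le> (SUP F\<in>finite_part (\<Union>i<n. E i). gap F)"
proof (induction n)
  case (Suc n)
  have "E i \<inter> E n = {}" if "i < n" for i
    using assms that by (simp add: disjoint_family_on_def)
  then have "(\<Union>i<n. E i) \<inter> E n = {}" by blast
  have "(\<Sum>i<Suc n. SUP F\<in>finite_part (E i). gap F) \<le>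
      (SUP F\<in>finite_part (\<Union>i<n. E i). gap F) + (SUP F\<in>finite_part (E n). gap F)"
    using Suc by (simp add: add_right_mono)
  also have "\<dots> \<le> (SUP F\<in>finite_part ((\<Union>i<n. E i) \<union> E n). gap F)"
    by (rule SUP_gap_superadditive) fact
  also have "(\<Union>i<n. E i) \<union> E n = (\<Union>i<Suc n. E i)"
    by (auto simp: less_Suc_eq)
  finally show ?case .
qed simp

text \<open>Countable additivity has two halves. Superadditivity bounds every partial sum by the
  value on the union. Conversely, a finite piece \<open>F\<close> of the union is cut along the
  \<open>E i\<close>, and the gap is countably additive on the parts because \<open>\<nu>\<close> is
  finite on \<open>F\<close>.\<close>

lemma emeasure_difference_measure:
  assumes "E \<in> sets borel"
  shows "emeasure (difference_measure A \<mu> \<nu>) E = (SUP F\<in>finite_part E. gap F)"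
proof (rule emeasure_measure_of[OF difference_measure_def])
  show "sets borel \<subseteq> Pow (UNIV :: 'a set)" by simp
  show "E \<in> sets (difference_measure A \<mu> \<nu>)" using assms by simp
  have "gap F = 0" if "F \<in> finite_part {}" for F using that by auto
  then show "positive (sets (difference_measure A \<mu> \<nu>)) (\<lambda>E. SUP F\<in>finite_part E. gap F)"
    by (auto simp: positive_def intro!: antisym SUP_least)
  show "countably_additive (sets (difference_measure A \<mu> \<nu>)) (\<lambda>E. SUP F\<in>finite_part E. gap F)"
  proof (rule countably_additiveI)
    fix E :: "nat \<Rightarrow> 'a set"
    assume "range E \<subseteq> sets (difference_measure A \<mu> \<nu>)" and disj: "disjoint_family E"
    then have E: "\<And>i. E i \<in> sets borel" by auto
    show "(\<Sum>i. SUP F\<in>finite_part (E i). gap F) = (SUP F\<in>finite_part (\<Union>i. E i). gap F)"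
    proof (rule antisym)
      show "(\<Sum>i. SUP F\<in>finite_part (E i). gap F) \<le> (SUP F\<in>finite_part (\<Union>i. E i). gap F)"
      proof (rule suminf_le_const[OF summableI])
        fix n
        have "(\<Sum>i<n. SUP F\<in>finite_part (E i). gap F) \<le> (SUP F\<in>finite_part (\<Union>i<n. E i). gap F)"
          using disj by (rule SUP_gap_sum_le)
        also have "\<dots> \<le> (SUP F\<in>finite_part (\<Union>i. E i). gap F)"
          by (rule SUP_subset_mono) auto
        finally show "(\<Sum>i<n. SUP F\<in>finite_part (E i). gap F) \<le>
            (SUP F\<in>finite_part (\<Union>i. E i). gap F)" .
      qed
      show "(SUP F\<in>finite_part (\<Union>i. E i). gap F) \<le> (\<Sum>i. SUP F\<in>finite_part (E i). gap F)"
      proof (rule SUP_least)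
        fix F assume F: "F \<in> finite_part (\<Union>i. E i)"
        have part: "F \<inter> E i \<in> finite_part (E i)" for i
          using F E borel le_less_trans[OF emeasure_borel_mono[of \<nu> "F \<inter> E i" F]] by auto
        have split: "emeasure \<rho> F = (\<Sum>i. emeasure \<rho> (F \<inter> E i))" if "\<rho> \<in> borel_measures" for \<rho> :: "'a measure"
        proof -
          have range: "range (\<lambda>i. F \<inter> E i) \<subseteq> sets \<rho>"
            using that F E by auto
          have "disjoint_family (\<lambda>i. F \<inter> E i)"
            using disj by (auto simp: disjoint_family_on_def)
          moreover have "(\<Union>i. F \<inter> E i) = F" using F by auto
          ultimately show ?thesis
            using suminf_emeasure[OF range] by simp
        qed
        have "gap F = (\<Sum>i. gap (F \<inter> E i))"
        proof (rule gap_eqI[OF F])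
          show "emeasure \<mu> F + (\<Sum>i. gap (F \<inter> E i)) = emeasure \<nu> F"
            unfolding split[OF borel(1)] split[OF borel(2)] suminf_add[OF summableI summableI]
            by (simp only: emeasure_add_gap[OF part])
        qed
        also have "\<dots> \<le> (\<Sum>i. SUP F\<in>finite_part (E i). gap F)"
          by (intro suminf_le summableI SUP_upper part)
        finally show "gap F \<le> (\<Sum>i. SUP F\<in>finite_part (E i). gap F)" .
      qed
    qed
  qed
qed

text \<open>On a finite piece \<open>F\<close> the gap turns \<open>\<mu>\<close> into
  \<open>\<nu>\<close>; on the rest \<open>E - F\<close> domination is enough.\<close>

lemma add_difference_measure_le:
  assumes E: "E \<in> sets borel" "E \<subseteq> - A"
  shows "emeasure \<mu> E + emeasure (difference_measure A \<mu> \<nu>) E \<le> emeasure \<nu> E"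
  unfolding emeasure_difference_measure[OF E(1)] ennreal_SUP_add_right[OF finite_part_nonempty]
proof (rule SUP_least)
  fix F assume F: "F \<in> finite_part E"
  have split: "emeasure \<rho> E = emeasure \<rho> (E - F) + emeasure \<rho> F" if "\<rho> \<in> borel_measures" for \<rho> :: "'a measure"
    using that E F by (subst plus_emeasure) (auto intro!: arg_cong[where f = "emeasure \<rho>"])
  have "emeasure \<mu> E + gap F = emeasure \<mu> (E - F) + emeasure \<nu> F"
    unfolding split[OF borel(1)] add.assoc emeasure_add_gap[OF F] ..
  also have "\<dots> \<le> emeasure \<nu> (E - F) + emeasure \<nu> F"
    using E F by (intro add_right_mono dominated) auto
  finally show "emeasure \<mu> E + gap F \<le> emeasure \<nu> E"
    unfolding split[OF borel(2)] .
qed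

text \<open>Tightness of \<open>\<nu>\<close> reduces the missing inequality to compact subsets of
  \<open>E\<close>, and these have finite \<open>\<nu>\<close>-measure, so each is among the sets
  over which the difference is a supremum.\<close>

lemma add_difference_measure:
  assumes t: "tight A \<nu>" and fin: "\<And>K. compact K \<Longrightarrow> K \<subseteq> - A \<Longrightarrow> emeasure \<nu> K < \<infinity>"
    and E: "E \<in> sets borel" "E \<subseteq> - A"
  shows "emeasure \<mu> E + emeasure (difference_measure A \<mu> \<nu>) E = emeasure \<nu> E"
proof (rule antisym[OF add_difference_measure_le[OF E]])
  show "emeasure \<nu> E \<le> emeasure \<mu> E + emeasure (difference_measure A \<mu> \<nu>) E"
    unfolding tightD[OF t E]
  proof (rule SUP_least)
    fix K assume "K \<in> {K. compact K \<and> K \<subseteq> E}"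
    then have K: "compact K" "K \<subseteq> E" by auto
    then have part: "K \<in> finite_part E"
      using E fin[of K] borel_compact[of K] by auto
    have "emeasure \<nu> K = emeasure \<mu> K + gap K" using emeasure_add_gap[OF part] ..
    also have "\<dots> \<le> emeasure \<mu> E + emeasure (difference_measure A \<mu> \<nu>) E"
      using part K E borel unfolding emeasure_difference_measure[OF E(1)]
      by (intro add_mono emeasure_borel_mono SUP_upper) auto
    finally show "emeasure \<nu> K \<le> emeasure \<mu> E + emeasure (difference_measure A \<mu> \<nu>) E" .
  qed
qed

text \<open>Compact approximation of a difference is awkward, as \<open>\<mu>\<close> enters with a
  minus sign. Moving \<open>\<mu>\<close> to the other side leaves a bound on
  \<open>emeasure \<nu> F\<close>, to which tightness of \<open>\<nu>\<close> applies.\<close>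

lemma tight_difference_measure:
  assumes t: "tight A \<nu>" and fin: "\<And>K. compact K \<Longrightarrow> K \<subseteq> - A \<Longrightarrow> emeasure \<nu> K < \<infinity>"
  shows "tight A (difference_measure A \<mu> \<nu>)"
proof (rule tightI)
  fix E :: "'a set"
  assume E: "E \<in> sets borel" "E \<subseteq> - A"
  let ?\<delta> = "difference_measure A \<mu> \<nu>"
  let ?s = "SUP K\<in>{K. compact K \<and> K \<subseteq> E}. emeasure ?\<delta> K"
  show "emeasure ?\<delta> E \<le> ?s"
    unfolding emeasure_difference_measure[OF E(1)]
  proof (rule SUP_least)
    fix F assume F: "F \<in> finite_part E"
    then have F': "F \<in> sets borel" "F \<subseteq> - A" "F \<subseteq> E" by auto
    have "emeasure \<nu> F \<le> emeasure \<mu> F + ?s"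
      unfolding tightD[OF t F'(1,2)]
    proof (rule SUP_least)
      fix K assume "K \<in> {K. compact K \<and> K \<subseteq> F}"
      then have K: "compact K" "K \<subseteq> F" by auto
      then have "emeasure \<nu> K = emeasure \<mu> K + emeasure ?\<delta> K"
        using F' borel_compact[of K] by (intro add_difference_measure[OF t fin, symmetric]) auto
      also have "\<dots> \<le> emeasure \<mu> F + ?s"
        using K F' borel by (intro add_mono emeasure_borel_mono SUP_upper) auto
      finally show "emeasure \<nu> K \<le> emeasure \<mu> F + ?s" .
    qed
    \<comment> \<open>Finiteness rules out \<infinity> - \<infinity> when
      \<open>emeasure \<mu> F\<close> is moved back.\<close>
    moreover have "emeasure \<nu> F \<noteq> \<infinity>" using F by (simp add: less_top)
    ultimately show "gap F \<le> ?s" by (simp only: ennreal_minus_le_iff infinity_ennreal_def simp_thms)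
  qed
qed simp

end

section \<open>The cone of relative measures\<close>

locale metric_pair =
  fixes A :: "'a::metric_space set" and p :: ennreal
  assumes closed: "closed A" and nonempty: "A \<noteq> {}"
begin

definition rel_class :: "'a measure \<Rightarrow> 'a measure set" where
  "rel_class \<mu> = rel_equiv A `` {\<mu>}"

definition admissible :: "'a measure \<Rightarrow> bool" where
  "admissible \<mu> \<longleftrightarrow> \<mu> \<in> borel_measures \<and> tight A \<mu> \<and> locally_p_finite A p \<mu>"

abbreviation C :: "'a measure set cone" where
  "C \<equiv> locally_finite_measures_cone A p"

lemma admissible_borel [simp]: "admissible \<mu> \<Longrightarrow> \<mu> \<in> borel_measures"
  by (simp add: admissible_def)

lemma rel_class_eq_iff:
  assumes "\<mu> \<in> borel_measures" "\<nu> \<in> borel_measures"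
  shows "rel_class \<mu> = rel_class \<nu> \<longleftrightarrow>
    (\<forall>E\<in>sets borel. E \<subseteq> - A \<longrightarrow> emeasure \<mu> E = emeasure \<nu> E)"
  using assms unfolding rel_class_def
  by (simp add: eq_equiv_class_iff[OF equiv_rel_equiv[OF closed]] rel_equiv_iff[OF closed])

lemma rel_class_eqI:
  assumes "\<mu> \<in> borel_measures" "\<nu> \<in> borel_measures"
    and "\<And>E. E \<in> sets borel \<Longrightarrow> E \<subseteq> - A \<Longrightarrow> emeasure \<mu> E = emeasure \<nu> E"
  shows "rel_class \<mu> = rel_class \<nu>"
  using assms by (simp add: rel_class_eq_iff)

lemma self_in_rel_class: "\<mu> \<in> borel_measures \<Longrightarrow> \<mu> \<in> rel_class \<mu>"
  unfolding rel_class_def by (rule equiv_class_self[OF equiv_rel_equiv[OF closed]])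

lemma relative_measures_eq: "relative_measures A = rel_class ` borel_measures"
  by (auto simp: relative_measures_def quotient_def rel_class_def)

lemma rel_class_in_finite_measures_iff:
  assumes "\<mu> \<in> borel_measures"
  shows "rel_class \<mu> \<in> finite_measures A p \<longleftrightarrow> tight A \<mu> \<and> p_finite A p \<mu>"
proof -
  have "tight A \<nu> = tight A \<mu>" "p_finite A p \<nu> = p_finite A p \<mu>" if "\<nu> \<in> rel_class \<mu>" for \<nu>
    using that tight_rel_equiv[OF closed, of \<mu> \<nu>] p_finite_rel_equiv[OF closed, of \<mu> \<nu> p]
    by (auto simp: rel_class_def)
  then have "(\<forall>\<nu>\<in>rel_class \<mu>. tight A \<nu> \<and> p_finite A p \<nu>) \<longleftrightarrow> tight A \<mu> \<and> p_finite A p \<mu>"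
    using self_in_rel_class[OF assms] by blast
  then show ?thesis
    using assms by (simp add: finite_measures_def relative_measures_eq)
qed

lemma rel_class_in_carrier_iff:
  assumes "\<mu> \<in> borel_measures"
  shows "rel_class \<mu> \<in> carrier C \<longleftrightarrow> admissible \<mu>"
proof -
  have "tight A \<nu> = tight A \<mu>" "locally_p_finite A p \<nu> = locally_p_finite A p \<mu>"
    if "\<nu> \<in> rel_class \<mu>" for \<nu>
    using that tight_rel_equiv[OF closed, of \<mu> \<nu>] locally_p_finite_rel_equiv[OF closed, of \<mu> \<nu> p]
    by (auto simp: rel_class_def)
  then have "(\<forall>\<nu>\<in>rel_class \<mu>. tight A \<nu> \<and> locally_p_finite A p \<nu>) \<longleftrightarrow>
      tight A \<mu> \<and> locally_p_finite A p \<mu>"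
    using self_in_rel_class[OF assms] by blast
  then show ?thesis
    using assms by (simp add: locally_finite_measures_cone_def locally_finite_measures_def
        relative_measures_eq admissible_def)
qed

lemma rel_class_in_carrier [simp]: "admissible \<mu> \<Longrightarrow> rel_class \<mu> \<in> carrier C"
  by (simp add: rel_class_in_carrier_iff)

lemma carrierE:
  assumes "x \<in> carrier C"
  obtains \<mu> where "x = rel_class \<mu>" "admissible \<mu>"
proof -
  have "x \<in> relative_measures A"
    using assms by (simp add: locally_finite_measures_cone_def locally_finite_measures_def)
  then show thesis
    using assms that rel_class_in_carrier_iff by (auto simp: relative_measures_eq)
qed

lemma finite_measuresE:
  assumes "x \<in> finite_measures A p"
  obtains \<mu> where "x = rel_class \<mu>" "admissible \<mu>" "p_finite A p \<mu>"
proof -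
  have "x \<in> relative_measures A" using assms by (simp add: finite_measures_def)
  then obtain \<mu> where "x = rel_class \<mu>" "\<mu> \<in> borel_measures" by (auto simp: relative_measures_eq)
  then show thesis
    using assms that p_finite_imp_locally_p_finite
    by (auto simp: rel_class_in_finite_measures_iff admissible_def)
qed

lemma cadd_rel_class [simp]:
  assumes "\<mu> \<in> borel_measures" "\<nu> \<in> borel_measures"
  shows "rel_class \<mu> \<boxplus>\<^bsub>C\<^esub> rel_class \<nu> = rel_class (add_measure \<mu> \<nu>)"
proof -
  have "rel_class (add_measure \<mu>' \<nu>') = rel_class (add_measure \<mu> \<nu>)"
    if "\<mu>' \<in> rel_class \<mu>" "\<nu>' \<in> rel_class \<nu>" for \<mu>' \<nu>'
    using that unfolding rel_class_def
    by (intro equiv_class_eq[OF equiv_rel_equiv[OF closed], symmetric] add_measure_rel_equiv closed)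
      auto
  then have "(\<Union>\<mu>'\<in>rel_class \<mu>. \<Union>\<nu>'\<in>rel_class \<nu>. rel_class (add_measure \<mu>' \<nu>')) =
      (\<Union>\<mu>'\<in>rel_class \<mu>. \<Union>\<nu>'\<in>rel_class \<nu>. rel_class (add_measure \<mu> \<nu>))"
    by (intro SUP_cong refl) blast
  \<comment> \<open>A union of constant sets collapses because both classes are nonempty.\<close>
  also have "\<dots> = rel_class (add_measure \<mu> \<nu>)"
    using assms[THEN self_in_rel_class] by blast
  finally show ?thesis
    by (simp add: locally_finite_measures_cone_def rel_add_def flip: rel_class_def)
qed

lemma cscale_rel_class [simp]:
  assumes "\<mu> \<in> borel_measures"
  shows "a \<cdot>\<^bsub>C\<^esub> rel_class \<mu> = rel_class (scale_measure (ennreal a) \<mu>)"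
proof -
  have "rel_class (scale_measure (ennreal a) \<mu>') = rel_class (scale_measure (ennreal a) \<mu>)"
    if "\<mu>' \<in> rel_class \<mu>" for \<mu>'
    using that unfolding rel_class_def
    by (intro equiv_class_eq[OF equiv_rel_equiv[OF closed], symmetric] scale_measure_rel_equiv closed)
      auto
  then have "(\<Union>\<mu>'\<in>rel_class \<mu>. rel_class (scale_measure (ennreal a) \<mu>')) =
      (\<Union>\<mu>'\<in>rel_class \<mu>. rel_class (scale_measure (ennreal a) \<mu>))"
    by (intro SUP_cong refl) blast
  also have "\<dots> = rel_class (scale_measure (ennreal a) \<mu>)"
    using self_in_rel_class[OF assms] by blast
  finally show ?thesis
    by (simp add: locally_finite_measures_cone_def rel_scale_def flip: rel_class_def)
qed

lemma czero_eq [simp]: "\<zero>\<^sub>C\<^bsub>C\<^esub> = rel_class (null_measure borel)"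
  by (simp add: locally_finite_measures_cone_def rel_zero_def rel_class_def)

section \<open>Closure properties and the natural order\<close>

lemma admissible_add [simp]:
  assumes "admissible \<mu>" "admissible \<nu>"
  shows "admissible (add_measure \<mu> \<nu>)"
  using assms tight_add_measure[of \<mu> \<nu> A]
    locally_p_finite_dominated[OF closed, of \<mu> \<nu> "add_measure \<mu> \<nu>" 1 p]
  by (simp add: admissible_def emeasure_add_measure)

lemma admissible_scale [simp]:
  assumes "admissible \<mu>"
  shows "admissible (scale_measure (ennreal a) \<mu>)"
  \<comment> \<open>\<open>ennreal a\<close> is finite for every real \<open>a\<close> (0 for
    negative \<open>a\<close>), so it can be the domination constant.\<close>
  using assms tight_scale_measure[of A \<mu>]
    locally_p_finite_dominated[OF closed, of \<mu> \<mu> "scale_measure (ennreal a) \<mu>" "ennreal a" p]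
  by (simp add: admissible_def mult_left_mono)

lemma admissible_sup [simp]:
  assumes "admissible \<mu>" "admissible \<nu>"
  shows "admissible (sup_measure' \<mu> \<nu>)"
  using assms tight_sup_measure'[of \<mu> \<nu> A]
    locally_p_finite_dominated[OF closed, of \<mu> \<nu> "sup_measure' \<mu> \<nu>" 1 p]
  by (simp add: admissible_def emeasure_sup_measure'_le_add)

lemma admissible_null [simp]: "admissible (null_measure borel)"
proof -
  have "tight A (null_measure borel)" by (rule tightI) simp_all
  then show ?thesis
    by (simp add: admissible_def p_finite_imp_locally_p_finite p_finite_null_measure)
qed

lemma compact_finite:
  "admissible \<mu> \<Longrightarrow> compact K \<Longrightarrow> K \<subseteq> - A \<Longrightarrow> emeasure \<mu> K < \<infinity>"
  using emeasure_compact_finite[OF closed nonempty, of \<mu> p K] by (simp add: admissible_def)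

text \<open>A complement only adds nonnegative values. Conversely
  \<open>difference_measure A \<mu> \<nu>\<close> is a complement in the cone: it is tight because
  \<open>\<nu>\<close> is, and locally \<open>p\<close>-finite because \<open>\<nu>\<close>
  dominates it.\<close>

lemma natural_order_iff:
  assumes \<mu>: "admissible \<mu>" and \<nu>: "admissible \<nu>"
  shows "rel_class \<mu> \<sqsubseteq>\<^bsub>natural_order C\<^esub> rel_class \<nu> \<longleftrightarrow>
    (\<forall>E\<in>sets borel. E \<subseteq> - A \<longrightarrow> emeasure \<mu> E \<le> emeasure \<nu> E)" (is "?L \<longleftrightarrow> ?R")
proof
  assume ?L
  then obtain \<rho> where \<rho>: "admissible \<rho>" "rel_class \<mu> \<boxplus>\<^bsub>C\<^esub> rel_class \<rho> = rel_class \<nu>"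
    by (auto simp: natural_order_def elim: carrierE)
  then have "\<forall>E\<in>sets borel. E \<subseteq> - A \<longrightarrow> emeasure \<mu> E + emeasure \<rho> E = emeasure \<nu> E"
    using \<mu> \<nu> by (simp add: rel_class_eq_iff emeasure_add_measure)
  then show ?R by (metis le_iff_add)
next
  assume R: ?R
  then interpret dominated_measures A \<mu> \<nu>
    using closed \<mu> \<nu> by unfold_locales auto
  let ?\<rho> = "difference_measure A \<mu> \<nu>"
  have t: "tight A \<nu>" using \<nu> by (simp add: admissible_def)
  have eq: "emeasure \<mu> E + emeasure ?\<rho> E = emeasure \<nu> E" if "E \<in> sets borel" "E \<subseteq> - A" for E
    using add_difference_measure[OF t compact_finite[OF \<nu>] that] .
  \<comment> \<open>\<open>\<nu>\<close> is doubled only to fit the two-measure form of the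
    domination lemma.\<close>
  have "emeasure ?\<rho> E \<le> 1 * (emeasure \<nu> E + emeasure \<nu> E)" if "E \<in> sets borel" "E \<subseteq> - A" for E
    using eq[OF that] by (metis add.commute add_increasing le_iff_add mult_1 zero_le)
  then have "admissible ?\<rho>"
    using \<nu> tight_difference_measure[OF t compact_finite[OF \<nu>]]
      locally_p_finite_dominated[OF closed, of \<nu> \<nu> ?\<rho> 1 p]
    by (simp add: admissible_def)
  moreover have "rel_class \<mu> \<boxplus>\<^bsub>C\<^esub> rel_class ?\<rho> = rel_class \<nu>"
    using \<mu> \<nu> eq by (simp add: rel_class_eq_iff emeasure_add_measure)
  ultimately show ?L
    by (auto simp: natural_order_def intro!: bexI[of _ "rel_class ?\<rho>"])
qed

lemma carrier_natural_order [simp]: "carrier (natural_order C) = carrier C"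
  by (simp add: natural_order_def)

lemma abstract_convex_cone: "abstract_convex_cone C"
proof (rule abstract_convex_cone.intro)
  note simps = additive_monoid_def partial_object.simps monoid.simps czero_eq cadd_rel_class
    admissible_borel add_measure_borel null_measure_borel
  show "comm_monoid (additive_monoid C)"
  proof (rule comm_monoidI, goal_cases)
    \<comment> \<open>Commutativity, whose permutative rewrite rule stays out of the other
      cases.\<close>
    case (5 x y)
    then show ?case
      by (auto simp only: simps add_measure_commute elim!: carrierE)
  qed (auto simp only: simps admissible_add admissible_null rel_class_in_carrier add_measure_assoc
      add_null_measure elim!: carrierE)
qed (auto simp only: cadd_rel_class cscale_rel_class czero_eq admissible_borel add_measure_borel
    scale_measure_borel null_measure_borel rel_class_in_carrier admissible_scale scale_add_measure
    scale_measure_add scale_measure_1 scale_measure_zero scale_measure_mult scale_null_measure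
    ennreal_plus ennreal_mult ennreal_1 ennreal_0 elim!: carrierE)

text \<open>Infinite values of \<open>\<rho>\<close> cannot be cancelled, but on compact sets off
  \<open>A\<close> it is finite. Equality there extends to Borel sets off \<open>A\<close> by
  tightness of \<open>\<mu>\<close> and \<open>\<nu>\<close>.\<close>

lemma cancel:
  assumes "admissible \<mu>" "admissible \<nu>" "admissible \<rho>"
    and eq: "rel_class (add_measure \<mu> \<rho>) = rel_class (add_measure \<nu> \<rho>)"
  shows "rel_class \<mu> = rel_class \<nu>"
proof (rule rel_class_eqI)
  fix E :: "'a set"
  assume E: "E \<in> sets borel" "E \<subseteq> - A"
  have "emeasure \<mu> K = emeasure \<nu> K" if K: "compact K" "K \<subseteq> E" for K
  proof -
    have "emeasure \<mu> K + emeasure \<rho> K = emeasure \<nu> K + emeasure \<rho> K"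
      using eq assms K E borel_compact[OF K(1)] by (simp add: rel_class_eq_iff emeasure_add_measure)
    moreover have "emeasure \<rho> K \<noteq> \<infinity>"
      using compact_finite[OF assms(3) K(1) order_trans[OF K(2) E(2)]] by simp
    ultimately show ?thesis
      by (metis ennreal_add_diff_cancel_right infinity_ennreal_def)
  qed
  then show "emeasure \<mu> E = emeasure \<nu> E"
    using assms E tightD[of A \<mu> E] tightD[of A \<nu> E] by (simp add: admissible_def cong: SUP_cong_simp)
qed (use assms in auto)

lemma partial_order_natural_order: "partial_order (natural_order C)"
proof -
  \<comment> \<open>With plain equality as \<open>eq\<close>, the congruence laws of
    \<open>partial_order\<close> are trivial.\<close>
  have eq: "(.=\<^bsub>natural_order C\<^esub>) = (=)" by (simp add: natural_order_def)
  have refl: "x \<sqsubseteq>\<^bsub>natural_order C\<^esub> x" if "x \<in> carrier C" for x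
    using that by (auto simp: natural_order_iff elim!: carrierE)
  have antisym: "x = y"
    if le: "x \<sqsubseteq>\<^bsub>natural_order C\<^esub> y" "y \<sqsubseteq>\<^bsub>natural_order C\<^esub> x" and carrier: "x \<in> carrier C" "y \<in> carrier C" for x y
  proof -
    obtain \<mu> \<nu> where x: "x = rel_class \<mu>" "admissible \<mu>" and y: "y = rel_class \<nu>" "admissible \<nu>"
      using carrier by (metis carrierE)
    show ?thesis
      unfolding x(1) y(1)
    proof (rule rel_class_eqI)
      fix E :: "'a set" assume "E \<in> sets borel" "E \<subseteq> - A"
      then show "emeasure \<mu> E = emeasure \<nu> E"
        using le x(2) y(2) by (auto simp: x(1) y(1) natural_order_iff intro: order.antisym)
    qed (use x y in auto)
  qed
  have trans: "x \<sqsubseteq>\<^bsub>natural_order C\<^esub> z"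
    if le: "x \<sqsubseteq>\<^bsub>natural_order C\<^esub> y" "y \<sqsubseteq>\<^bsub>natural_order C\<^esub> z"
      and carrier: "x \<in> carrier C" "y \<in> carrier C" "z \<in> carrier C" for x y z
  proof -
    obtain \<mu> \<nu> \<rho> where x: "x = rel_class \<mu>" "admissible \<mu>"
      and y: "y = rel_class \<nu>" "admissible \<nu>" and z: "z = rel_class \<rho>" "admissible \<rho>"
      using carrier by (metis carrierE)
    show ?thesis
      using le x(2) y(2) z(2) unfolding x(1) y(1) z(1)
      by (simp add: natural_order_iff) (meson order_trans)
  qed
  show ?thesis
    by (unfold_locales, simp_all add: eq) (rule refl antisym trans; assumption)+
qed

lemma least_sup_measure':
  assumes "admissible \<mu>" "admissible \<nu>"
  shows "least (natural_order C) (rel_class (sup_measure' \<mu> \<nu>))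
    (Upper (natural_order C) {rel_class \<mu>, rel_class \<nu>})"
  unfolding least_def
proof (intro conjI ballI)
  show "Upper (natural_order C) {rel_class \<mu>, rel_class \<nu>} \<subseteq> carrier (natural_order C)"
    by (rule Upper_closed)
  show "rel_class (sup_measure' \<mu> \<nu>) \<in> Upper (natural_order C) {rel_class \<mu>, rel_class \<nu>}"
    using assms le_emeasure_sup_measure'1[of \<nu> \<mu>] le_emeasure_sup_measure'2[of \<nu> \<mu>]
    by (auto simp: Upper_def natural_order_iff)
  fix x assume x: "x \<in> Upper (natural_order C) {rel_class \<mu>, rel_class \<nu>}"
  then have "x \<in> carrier C" by (simp add: Upper_def)
  then obtain \<rho> where \<rho>: "x = rel_class \<rho>" "admissible \<rho>" by (rule carrierE)
  then have "rel_class \<mu> \<sqsubseteq>\<^bsub>natural_order C\<^esub> rel_class \<rho>" "rel_class \<nu> \<sqsubseteq>\<^bsub>natural_order C\<^esub> rel_class \<rho>"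
    using x assms by (auto simp: Upper_def)
  then have le: "emeasure \<mu> E \<le> emeasure \<rho> E" "emeasure \<nu> E \<le> emeasure \<rho> E"
    if "E \<in> sets borel" "E \<subseteq> - A" for E
    using assms \<rho> that by (auto simp: natural_order_iff)
  \<comment> \<open>The upper bound on \<open>E\<close> uses domination by \<open>\<rho>\<close> on
    all Borel subsets of \<open>E\<close>; these stay off \<open>A\<close>, where \<open>le\<close>
    applies.\<close>
  show "rel_class (sup_measure' \<mu> \<nu>) \<sqsubseteq>\<^bsub>natural_order C\<^esub> x"
    using assms \<rho>(2) le by (auto simp: \<rho>(1) natural_order_iff intro!: emeasure_sup_measure'_le2)
qed

text \<open>The join is picked by Hilbert choice; uniqueness of least elements in a partial order
  identifies it with the concrete supremum.\<close>

lemma join_rel_class: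
  assumes "admissible \<mu>" "admissible \<nu>"
  shows "rel_class \<mu> \<squnion>\<^bsub>natural_order C\<^esub> rel_class \<nu> = rel_class (sup_measure' \<mu> \<nu>)"
  unfolding join_def Lattice.sup_def
  using least_sup_measure'[OF assms]
  by (rule some_equality)
    (rule partial_order.least_unique[OF partial_order_natural_order _ least_sup_measure'[OF assms]])

lemma riesz_cone: "riesz_cone C"
proof -
  interpret abstract_convex_cone C by (rule abstract_convex_cone)
  interpret partial_order "natural_order C" by (rule partial_order_natural_order)
  show ?thesis
  proof
    show "\<exists>s. least (natural_order C) s (Upper (natural_order C) {x, y})"
      if "x \<in> carrier (natural_order C)" "y \<in> carrier (natural_order C)" for x y
      using that least_sup_measure' by (auto elim!: carrierE)
  next
    fix x y z assume "x \<in> carrier C" "y \<in> carrier C" "z \<in> carrier C"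
    then obtain \<mu> \<nu> \<rho> where x: "x = rel_class \<mu>" "admissible \<mu>"
      and y: "y = rel_class \<nu>" "admissible \<nu>" and z: "z = rel_class \<rho>" "admissible \<rho>"
      by (metis carrierE)
    show "x = y" if "x \<boxplus>\<^bsub>C\<^esub> z = y \<boxplus>\<^bsub>C\<^esub> z"
      using that x(2) y(2) z(2) cancel[of \<mu> \<nu> \<rho>] by (simp add: x(1) y(1) z(1))
    show "(x \<squnion>\<^bsub>natural_order C\<^esub> y) \<boxplus>\<^bsub>C\<^esub> z = (x \<boxplus>\<^bsub>C\<^esub> z) \<squnion>\<^bsub>natural_order C\<^esub> (y \<boxplus>\<^bsub>C\<^esub> z)"
      using x(2) y(2) z(2) by (simp add: x(1) y(1) z(1) join_rel_class sup_measure'_add_right)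
  qed
qed

lemma zero_sum_free_riesz_cone: "zero_sum_free_riesz_cone C"
proof -
  interpret riesz_cone C by (rule riesz_cone)
  show ?thesis
  proof
    fix x y assume "x \<in> carrier C" "y \<in> carrier C" and sum: "x \<boxplus>\<^bsub>C\<^esub> y = \<zero>\<^sub>C\<^bsub>C\<^esub>"
    then obtain \<mu> \<nu> where x: "x = rel_class \<mu>" "admissible \<mu>" and y: "y = rel_class \<nu>" "admissible \<nu>"
      by (metis carrierE)
    have "emeasure \<mu> E + emeasure \<nu> E = 0" if "E \<in> sets borel" "E \<subseteq> - A" for E
      using sum that x(2) y(2) by (simp add: x(1) y(1) rel_class_eq_iff emeasure_add_measure)
    then show "x = \<zero>\<^sub>C\<^bsub>C\<^esub> \<and> y = \<zero>\<^sub>C\<^bsub>C\<^esub>"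
      using x(2) y(2) by (simp add: x(1) y(1) rel_class_eq_iff)
  qed
qed

section \<open>The ideal of globally \<open>p\<close>-finite measures\<close>

lemma riesz_subcone_finite_measures: "riesz_subcone (finite_measures A p) C"
  unfolding riesz_subcone_def
proof (intro conjI ballI allI impI)
  show "finite_measures A p \<subseteq> carrier C"
    by (auto elim!: finite_measuresE)
  show "\<zero>\<^sub>C\<^bsub>C\<^esub> \<in> finite_measures A p"
    using admissible_null by (simp add: rel_class_in_finite_measures_iff admissible_def p_finite_null_measure)
  fix x assume "x \<in> finite_measures A p"
  then obtain \<mu> where \<mu>: "x = rel_class \<mu>" "admissible \<mu>" "p_finite A p \<mu>" by (rule finite_measuresE)
  have b: "\<mu> \<in> borel_measures" using \<mu> by simp
  show "a \<cdot>\<^bsub>C\<^esub> x \<in> finite_measures A p" if "0 \<le> a" for a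
  proof -
    have "p_finite A p (scale_measure (ennreal a) \<mu>)"
      by (rule p_finite_dominated[OF closed b b _ _ _ \<mu>(3) \<mu>(3), of _ "ennreal a"])
        (use b in \<open>auto intro: mult_left_mono\<close>)
    then show ?thesis
      using \<mu> tight_scale_measure[of A \<mu>] by (simp add: rel_class_in_finite_measures_iff admissible_def)
  qed
  fix y assume "y \<in> finite_measures A p"
  then obtain \<nu> where \<nu>: "y = rel_class \<nu>" "admissible \<nu>" "p_finite A p \<nu>" by (rule finite_measuresE)
  have b': "\<nu> \<in> borel_measures" using \<nu> by simp
  have "p_finite A p (add_measure \<mu> \<nu>)"
    by (rule p_finite_dominated[OF closed b b' _ _ _ \<mu>(3) \<nu>(3), of _ 1])
      (use b b' in \<open>auto simp: emeasure_add_measure\<close>)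
  then show "x \<boxplus>\<^bsub>C\<^esub> y \<in> finite_measures A p"
    using \<mu> \<nu> b b' tight_add_measure[of \<mu> \<nu> A]
    by (simp add: rel_class_in_finite_measures_iff admissible_def)
  have "p_finite A p (sup_measure' \<mu> \<nu>)"
    by (rule p_finite_dominated[OF closed b b' _ _ _ \<mu>(3) \<nu>(3), of _ 1])
      (use b b' in \<open>auto simp: emeasure_sup_measure'_le_add\<close>)
  then show "x \<squnion>\<^bsub>natural_order C\<^esub> y \<in> finite_measures A p"
    using \<mu> \<nu> b b' tight_sup_measure'[of \<mu> \<nu> A]
    by (simp add: join_rel_class rel_class_in_finite_measures_iff admissible_def)
qed

lemma solid_finite_measures: "solid (finite_measures A p) C"
  unfolding solid_def
proof (intro conjI ballI impI)
  show "finite_measures A p \<subseteq> carrier C"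
    by (auto elim!: finite_measuresE)
  fix y x assume "y \<in> finite_measures A p" and "x \<in> carrier C" and le: "x \<sqsubseteq>\<^bsub>natural_order C\<^esub> y"
  then obtain \<nu> \<mu> where \<nu>: "y = rel_class \<nu>" "admissible \<nu>" "p_finite A p \<nu>"
    and \<mu>: "x = rel_class \<mu>" "admissible \<mu>"
    by (metis finite_measuresE carrierE)
  have b: "\<mu> \<in> borel_measures" "\<nu> \<in> borel_measures" using \<mu> \<nu> by auto
  \<comment> \<open>Solidity is the domination lemma with \<open>\<nu>\<close> as both bounding
    measures.\<close>
  have "emeasure \<mu> E \<le> 1 * (emeasure \<nu> E + emeasure \<nu> E)" if "E \<in> sets borel" "E \<subseteq> - A" for E
    using le \<mu> \<nu> that by (simp add: natural_order_iff add_increasing)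
  then have "p_finite A p \<mu>"
    by (intro p_finite_dominated[OF closed b(2) b(2) b(1) _ _ \<nu>(3) \<nu>(3), of 1]) auto
  then show "x \<in> finite_measures A p"
    using \<mu> b by (simp add: rel_class_in_finite_measures_iff admissible_def)
qed

end

theorem proposition4p15:
  fixes A :: "'a::metric_space set" and p :: ennreal
  assumes "closed A" and "A \<noteq> {}"
  shows "riesz_ideal (finite_measures A p) (locally_finite_measures_cone A p)"
proof -
  interpret metric_pair A p by unfold_locales (fact assms)+
  show ?thesis
    unfolding riesz_ideal_def
    using zero_sum_free_riesz_cone riesz_subcone_finite_measures solid_finite_measures by blast
qed

end
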